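(* Let $n\ge1$ be an integer, let $\eta_e,\eta_r,\eta_d,\lambda,\lambda_m\in(0,1]$ and $P_e,P_r,P_d\in[0,1)$. Let $Q_i$, $1\le i\le n+1$, be the quantum bit error rate obtained when Alice and Bob measure the state $\rho_i$ of the repeater chain, as defined in the context. Put $A_r=\eta_r\lambda_m+P_r(1-\eta_r\lambda_m)$, $B_r=1-(1-P_r)(1-\eta_r\lambda_m)^2$, $$a=\tfrac18\left[P_r^2(1-A_r)^2+A_r^2(1-P_r)^2\right],\quad b=\tfrac18\left[2A_rP_r(1-A_r)(1-P_r)\right],\quad c=\tfrac18P_r(1-P_r)\left[P_r(1-B_r)+B_r(1-P_r)\right],$$ $w_r=c/(a+b)$, $t_r=(1-2w_r)/(1+2w_r)$, and $A_d=\eta_d+(1-\eta_d)P_d$, $q_1=(1-P_d)A_d$, $q_2=(1-A_d)P_d$, $q_3=P_dA_d$, $t_d=\left((q_1-q_2)/(q_1+q_2+q_3)\right)^2$. Then $$1-2Q_{i+1}=\frac{t_r}{t_d}\,(1-2Q_i)^2,\qquad 1\le i\le n.$$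
   Context: Qubits and Bell states. A qubit is carried by two bosonic modes containing exactly one photon in total, with basis $|10\rangle,|01\rangle$ (photon-number states of the first and second mode). $|M^\pm\rangle=(|10,01\rangle\pm|01,10\rangle)/\sqrt2$. Detectors. A single-photon detector with dark-click probability $P$ and efficiency $\hat\eta$, acting on a mode with at most two photons, is the two-outcome POVM $F_0=(1-P)\left[\Pi_0+(1-\hat\eta)\Pi_1+(1-\hat\eta)^2\Pi_2\right]$ ("no click") and $F_1=\mathbb I-F_0$ ("click"), where $\Pi_k=|k\rangle\langle k|$ is the projector on the $k$-photon state. Transmission loss is absorbed in the efficiency. Bell-state measurement and swap. Given two-qubit states $\sigma_{ab}$ and $\tau_{cd}$, with qubit $b$ on modes $b_1,b_2$ and qubit $c$ on modes $c_1,c_2$, a Bell-state measurement (BSM) with detector parameters $(P,\hat\eta)$ first applies the beamsplitter unitary $U$ with $b_j^\dagger\mapsto(b_j^\dagger+c_j^\dagger)/\sqrt2$, $c_j^\dagger\mapsto(b_j^\dagger-c_j^\dagger)/\sqrt2$ ($j=1,2$, creation operators), and then detects the four modes $b_1,b_2,c_1,c_2$ (numbered $1,2,3,4$) with four such detectors. The BSM is successful if the set of clicking detectors is exactly $\{1,2\}$, $\{3,4\}$, $\{1,4\}$ or $\{2,3\}$. If $E$ is the POVM element of the outcome (e.g. $E=F_1\otimes F_1\otimes F_0\otimes F_0$ for $\{1,2\}$), the resulting state of $ad$ is ${\rm tr}_{bc}\left(\sqrt E\,U(\sigma\otimes\tau)U^\dagger\sqrt E\right)$ divided by the probability of the outcome;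 for the outcomes $\{1,4\}$ and $\{2,3\}$ the heralded sign is corrected by the phase flip $|01\rangle\mapsto-|01\rangle$ on qubit $d$ (interchanging the roles of $|M^+\rangle$ and $|M^-\rangle$), so that all four successful outcomes herald the same state, called the swapped state. Chain. $\rho_1$ is the swapped state obtained from $|M^+\rangle_{ab}|M^+\rangle_{cd}$ with detector parameters $(P_e,\eta_e\lambda)$. For $i\ge1$, $\rho_{i+1}$ is the swapped state obtained from two copies of $\rho_i$ with detector parameters $(P_r,\eta_r\lambda_m)$. QBER. Alice holds the first and Bob the second qubit of $\rho_i$. The four modes are detected by four detectors with parameters $(P_d,\eta_d)$; let $F_0,F_1$ be the corresponding POVM elements and $M_{jklm}=F_j\otimes F_k\otimes F_l\otimes F_m$. The sift probability is $$P_1={\rm Tr}\left[\rho_i(M_{0101}+M_{0110}+M_{1001}+M_{1010}+M_{1101}+M_{1110}+M_{0111}+M_{1011}+M_{1111})\right]$$ and $$Q_i=\frac1{P_1}{\rm Tr}\left[\rho_i\left(M_{0101}+M_{1010}+\tfrac12\{M_{1101}+M_{1110}+M_{0111}+M_{1011}+M_{1111}\}\right)\right].$$ *)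

theory Defs
  imports "HOL-Analysis.Analysis"
begin

text \<open>
  A Hilbert space with an orthonormal basis indexed by a finite type is represented by
  vectors over that type, an operator by its matrix, and the tensor product of two spaces
  by the product of the index types.
\<close>

type_synonym 'n ket = "complex ^ 'n"
type_synonym 'n operator = "complex ^ 'n ^ 'n"

definition dagger :: "'n::finite operator \<Rightarrow> 'n operator" where
  "dagger A = (\<chi> i j. cnj (A $ j $ i))"

definition density :: "'n::finite ket \<Rightarrow> 'n operator" where
  "density v = (\<chi> i j. v $ i * cnj (v $ j))"

definition tensor :: "'m::finite operator \<Rightarrow> 'n::finite operator \<Rightarrow> ('m \<times> 'n) operator"
  (infixr "\<otimes>\<^sub>o" 75) where
  "A \<otimes>\<^sub>o B = (\<chi> x y. A $ fst x $ fst y * B $ snd x $ snd y)"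

definition positive :: "'n::finite operator \<Rightarrow> bool" where
  "positive A \<longleftrightarrow> dagger A = A \<and> (\<forall>v. 0 \<le> Re (\<Sum>i\<in>UNIV. cnj (v $ i) * (A *v v) $ i))"

text \<open>A positive operator has exactly one positive square root, so the choice below is unique.\<close>

definition op_sqrt :: "'n::finite operator \<Rightarrow> 'n operator" where
  "op_sqrt A = (SOME R. positive R \<and> R ** R = A)"

text \<open>Photon-number basis of a mode that holds at most two photons.\<close>

datatype photons = N0 | N1 | N2

instance photons :: finite
proof
  have "(UNIV :: photons set) = {N0, N1, N2}"
    using photons.exhaust by blast
  then show "finite (UNIV :: photons set)"
    by (metis finite.emptyI finite_insert)
qed

primrec number :: "photons \<Rightarrow> nat" where
  "number N0 = 0"
| "number N1 = 1"
| "number N2 = 2"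

text \<open>
  A qubit is carried by a pair of modes.  States of qubits are kept as operators on the
  space of both modes, supported on the span of the two basis states
  \<open>(N1, N0)\<close> (that is \<open>|10\<rangle>\<close>) and \<open>(N0, N1)\<close> (that is \<open>|01\<rangle>\<close>).
\<close>

type_synonym modes2 = "photons \<times> photons"
type_synonym modes4 = "modes2 \<times> modes2"
type_synonym state2 = "modes4 operator"

definition M_plus :: "modes4 ket" where
  "M_plus = (1 / sqrt 2) *\<^sub>R (axis ((N1, N0), (N0, N1)) 1 + axis ((N0, N1), (N1, N0)) 1)"

definition phase_flip :: "modes2 operator" where
  "phase_flip = (\<chi> x y. if x = y then (if x = (N0, N1) then - 1 else 1) else 0)"

definition number_proj :: "photons \<Rightarrow> photons operator" where
  "number_proj k = density (axis k 1)"

text \<open>The first argument is the dark-click probability, the second the efficiency.\<close>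

definition no_click :: "real \<Rightarrow> real \<Rightarrow> photons operator" where
  "no_click P eta = (1 - P) *\<^sub>R
     (number_proj N0 + (1 - eta) *\<^sub>R number_proj N1 + (1 - eta)\<^sup>2 *\<^sub>R number_proj N2)"

definition detector :: "real \<Rightarrow> real \<Rightarrow> nat \<Rightarrow> photons operator" where
  "detector P eta j = (if j = 0 then no_click P eta else mat 1 - no_click P eta)"

definition detect4 :: "real \<Rightarrow> real \<Rightarrow> nat \<Rightarrow> nat \<Rightarrow> nat \<Rightarrow> nat \<Rightarrow> modes4 operator" where
  "detect4 P eta j k l m =
     (detector P eta j \<otimes>\<^sub>o detector P eta k) \<otimes>\<^sub>o (detector P eta l \<otimes>\<^sub>o detector P eta m)"

definition creation :: "photons operator" where
  "creation = (\<chi> p q. if number p = number q + 1 then of_real (sqrt (real (number p))) else 0)"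

text \<open>
  The image of the number state with \<open>m\<close> photons in the first and \<open>n\<close> in the second mode is
  obtained by substituting the transformed creation operators in
  \<open>(b\<^sup>\<dagger>)\<^sup>m (c\<^sup>\<dagger>)\<^sup>n |0,0\<rangle> / sqrt (m! n!)\<close>.  If \<open>m + n \<le> 2\<close>, the intermediate vectors have at most two
  photons, so that truncating the modes at two photons has no effect.  The beamsplitter conserves
  the photon number and its input here never exceeds two photons; on the remaining basis vectors
  it is put equal to the identity, which makes it unitary.
\<close>

definition beamsplitter_ket :: "photons \<Rightarrow> photons \<Rightarrow> modes2 ket" where
  "beamsplitter_ket p q =
     (let m = number p; n = number q;
          b = creation \<otimes>\<^sub>o mat 1; c = mat 1 \<otimes>\<^sub>o creation;
          b' = (1 / sqrt 2) *\<^sub>R (b + c); c' = (1 / sqrt 2) *\<^sub>R (b - c)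
      in if m + n \<le> 2
         then (1 / sqrt (fact m * fact n)) *\<^sub>R
                (((\<lambda>v. b' *v v) ^^ m) (((\<lambda>v. c' *v v) ^^ n) (axis (N0, N0) 1)))
         else axis (p, q) 1)"

definition beamsplitter :: "modes2 operator" where
  "beamsplitter = (\<chi> x y. beamsplitter_ket (fst y) (snd y) $ x)"

text \<open>
  Modes are ordered as \<open>((b\<^sub>1, b\<^sub>2), (c\<^sub>1, c\<^sub>2))\<close>; one beamsplitter acts on \<open>b\<^sub>1, c\<^sub>1\<close> and one on
  \<open>b\<^sub>2, c\<^sub>2\<close>.
\<close>

definition beamsplitters :: "modes4 operator" where
  "beamsplitters = (\<chi> x y. case (x, y) of
     (((b1, b2), (c1, c2)), ((b1', b2'), (c1', c2'))) \<Rightarrow>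
       beamsplitter $ (b1, c1) $ (b1', c1') * beamsplitter $ (b2, c2) $ (b2', c2'))"

text \<open>The four qubits are ordered as \<open>((a, b), (c, d))\<close>.\<close>

definition on_bc :: "modes4 operator \<Rightarrow> (modes4 \<times> modes4) operator" where
  "on_bc X = (\<chi> x y. case (x, y) of
     (((a, b), (c, d)), ((a', b'), (c', d'))) \<Rightarrow>
       if a = a' \<and> d = d' then X $ (b, c) $ (b', c') else 0)"

definition trace_bc :: "(modes4 \<times> modes4) operator \<Rightarrow> state2" where
  "trace_bc X = (\<chi> x y. case (x, y) of
     ((a, d), (a', d')) \<Rightarrow>
       \<Sum>b\<in>UNIV. \<Sum>c\<in>UNIV. X $ ((a, b), (c, d)) $ ((a', b), (c, d')))"

definition bsm_success :: "nat set set" where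
  "bsm_success = {{1, 2}, {3, 4}, {1, 4}, {2, 3}}"

definition bsm_povm :: "real \<Rightarrow> real \<Rightarrow> nat set \<Rightarrow> modes4 operator" where
  "bsm_povm P eta S =
     detect4 P eta (of_bool (1 \<in> S)) (of_bool (2 \<in> S)) (of_bool (3 \<in> S)) (of_bool (4 \<in> S))"

definition bsm_input :: "state2 \<Rightarrow> state2 \<Rightarrow> (modes4 \<times> modes4) operator" where
  "bsm_input \<sigma> \<tau> = on_bc beamsplitters ** (\<sigma> \<otimes>\<^sub>o \<tau>) ** dagger (on_bc beamsplitters)"

definition bsm_prob :: "real \<Rightarrow> real \<Rightarrow> state2 \<Rightarrow> state2 \<Rightarrow> nat set \<Rightarrow> real" where
  "bsm_prob P eta \<sigma> \<tau> S = Re (trace (on_bc (bsm_povm P eta S) ** bsm_input \<sigma> \<tau>))"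

definition bsm_state :: "real \<Rightarrow> real \<Rightarrow> state2 \<Rightarrow> state2 \<Rightarrow> nat set \<Rightarrow> state2" where
  "bsm_state P eta \<sigma> \<tau> S =
     (let R = on_bc (op_sqrt (bsm_povm P eta S))
      in (1 / bsm_prob P eta \<sigma> \<tau> S) *\<^sub>R trace_bc (R ** bsm_input \<sigma> \<tau> ** R))"

definition heralded_state :: "real \<Rightarrow> real \<Rightarrow> state2 \<Rightarrow> state2 \<Rightarrow> nat set \<Rightarrow> state2" where
  "heralded_state P eta \<sigma> \<tau> S =
     (let Z = mat 1 \<otimes>\<^sub>o phase_flip; \<rho> = bsm_state P eta \<sigma> \<tau> S
      in if S \<in> {{1, 4}, {2, 3}} then Z ** \<rho> ** dagger Z else \<rho>)"

text \<open>The common state heralded by all four successful outcomes.\<close>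

definition swapped_state :: "real \<Rightarrow> real \<Rightarrow> state2 \<Rightarrow> state2 \<Rightarrow> state2" where
  "swapped_state P eta \<sigma> \<tau> = (THE \<rho>. \<forall>S\<in>bsm_success. heralded_state P eta \<sigma> \<tau> S = \<rho>)"

text \<open>
  The states of the chain are those with index at least one; index zero stands for the Bell
  state from which the first of them is swapped.
\<close>

fun chain :: "real \<Rightarrow> real \<Rightarrow> real \<Rightarrow> real \<Rightarrow> nat \<Rightarrow> state2" where
  "chain Pe eta1 Pr eta2 0 = density M_plus"
| "chain Pe eta1 Pr eta2 (Suc 0) =
     swapped_state Pe eta1 (density M_plus) (density M_plus)"
| "chain Pe eta1 Pr eta2 (Suc (Suc i)) =
     swapped_state Pr eta2 (chain Pe eta1 Pr eta2 (Suc i)) (chain Pe eta1 Pr eta2 (Suc i))"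

definition sift_prob :: "real \<Rightarrow> real \<Rightarrow> state2 \<Rightarrow> real" where
  "sift_prob P eta \<rho> =
     (let M = detect4 P eta
      in Re (trace (\<rho> ** (M 0 1 0 1 + M 0 1 1 0 + M 1 0 0 1 + M 1 0 1 0 + M 1 1 0 1
                         + M 1 1 1 0 + M 0 1 1 1 + M 1 0 1 1 + M 1 1 1 1))))"

definition qber :: "real \<Rightarrow> real \<Rightarrow> state2 \<Rightarrow> real" where
  "qber P eta \<rho> =
     (let M = detect4 P eta
      in 1 / sift_prob P eta \<rho> *
         Re (trace (\<rho> ** (M 0 1 0 1 + M 1 0 1 0
              + (1 / 2) *\<^sub>R (M 1 1 0 1 + M 1 1 1 0 + M 0 1 1 1 + M 1 0 1 1 + M 1 1 1 1)))))"

end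

theory Submission
  imports Defs
begin

text \<open>
  Every state of the chain has, in the basis \<open>|10\<rangle>, |01\<rangle>\<close> of both qubits, population \<open>p\<close> on each of
  the two anticorrelated and \<open>g\<close> on each of the two correlated basis vectors (\<open>p + g = 1/2\<close>), and its
  only coherence is between the anticorrelated ones.  Detection sees only the contrast \<open>2 (p - g)\<close>, and
  \<open>1 - 2 Q = t\<^sub>d \<cdot> 2 (p - g)\<close>.  A successful measurement outcome with POVM element \<open>E\<close> acts through
  \<open>U\<^sup>\<dagger> E U\<close>; on the qubits its diagonal entries are \<open>u\<close> (opposite qubits) and \<open>k\<close> (equal qubits,
  which enter one beamsplitter together and bunch).  Hence the swap sends \<open>(p, g)\<close> to a multiple of
  \<open>(u (p\<^sup>2 + g\<^sup>2) + 2 k p g, k (p\<^sup>2 + g\<^sup>2) + 2 u p g)\<close>, so that \<open>p - g\<close> becomes \<open>(u - k) (p - g)\<^sup>2\<close> and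
  \<open>p + g\<close> becomes \<open>(u + k) (p + g)\<^sup>2\<close>, while \<open>t\<^sub>r = (u - k) / (u + k)\<close>.
\<close>

section \<open>Diagonal operators and their square roots\<close>

lemma scaleR_complex: "r *\<^sub>R (z :: complex) = of_real r * z"
  by (rule scaleR_conv_of_real)

text \<open>Every POVM element and the phase flip is diagonal with real entries in the photon-number
  basis, so most of the operator algebra becomes pointwise arithmetic of real functions.\<close>

definition diag :: "('n::finite \<Rightarrow> real) \<Rightarrow> 'n operator" where
  "diag f = (\<chi> i j. if i = j then complex_of_real (f i) else 0)"

lemma diag_nth: "diag f $ i $ j = (if i = j then complex_of_real (f i) else 0)"
  by (simp add: diag_def)

lemma diag_mult_nth: "(diag f ** A) $ i $ j = of_real (f i) * A $ i $ j"
  by (simp add: matrix_matrix_mult_def diag_def if_distrib[of "\<lambda>x. x * _"] cong: if_cong)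

lemma mult_diag_nth: "(A ** diag f) $ i $ j = A $ i $ j * of_real (f j)"
  by (simp add: matrix_matrix_mult_def diag_def if_distrib cong: if_cong)

lemma diag_add: "diag f + diag g = diag (\<lambda>i. f i + g i)"
  by (simp add: vec_eq_iff diag_nth)

lemma diag_diff: "diag f - diag g = diag (\<lambda>i. f i - g i)"
  by (simp add: vec_eq_iff diag_nth)

lemma diag_scaleR: "r *\<^sub>R diag f = diag (\<lambda>i. r * f i)"
  by (simp add: vec_eq_iff diag_nth) (simp add: scaleR_complex)

lemma mat_1_eq_diag: "mat 1 = diag (\<lambda>i. 1)"
  by (simp add: vec_eq_iff diag_nth mat_def)

lemma tensor_diag: "diag f \<otimes>\<^sub>o diag g = diag (\<lambda>x. f (fst x) * g (snd x))"
  by (auto simp: vec_eq_iff diag_nth tensor_def prod_eq_iff)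

lemma dagger_diag: "dagger (diag f) = diag f"
  by (simp add: vec_eq_iff diag_nth dagger_def)

lemma positive_diag:
  assumes "\<And>i. 0 \<le> f i"
  shows "positive (diag f)"
proof -
  have "0 \<le> Re (\<Sum>i\<in>UNIV. cnj (v $ i) * (diag f *v v) $ i)" for v
  proof -
    have "(diag f *v v) $ i = of_real (f i) * v $ i" for i
      by (simp add: matrix_vector_mult_def diag_def if_distrib[of "\<lambda>x. x * _"] cong: if_cong)
    then have "Re (cnj (v $ i) * (diag f *v v) $ i) = f i * (cmod (v $ i))\<^sup>2" for i
      by (simp add: cmod_power2 distrib_left; simp add: power2_eq_square)
    then show ?thesis
      by (simp add: sum_nonneg assms)
  qed
  then show ?thesis
    by (simp add: positive_def dagger_diag)
qed

text \<open>The entrywise root is a witness for the choice in \<open>op_sqrt\<close>, which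
  therefore has its defining property.\<close>

lemma op_sqrt_diag:
  assumes "\<And>i. 0 \<le> f i"
  shows "op_sqrt (diag f) ** op_sqrt (diag f) = diag f"
proof -
  let ?R = "diag (\<lambda>i. sqrt (f i))"
  have "?R ** ?R = diag f"
    by (auto simp: vec_eq_iff diag_mult_nth diag_nth assms simp flip: of_real_mult)
  moreover have "positive ?R"
    by (simp add: positive_diag assms)
  ultimately show ?thesis
    unfolding op_sqrt_def by (metis (mono_tags, lifting) someI_ex)
qed

section \<open>Detectors as diagonal operators\<close>

lemma UNIV_photons: "(UNIV :: photons set) = {N0, N1, N2}"
  using photons.exhaust by blast

lemma sum_photons: "(\<Sum>p\<in>UNIV. f p) = f N0 + f N1 + f N2"
  by (simp add: UNIV_photons add.assoc)

lemma sum_UNIV_prod: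
  fixes f :: "'a::finite \<times> 'b::finite \<Rightarrow> 'c::comm_monoid_add"
  shows "(\<Sum>x\<in>UNIV. f x) = (\<Sum>a\<in>UNIV. \<Sum>b\<in>UNIV. f (a, b))"
  by (simp add: sum.cartesian_product flip: UNIV_Times_UNIV)

lemma no_click_eq_diag: "no_click P eta = diag (\<lambda>k. (1 - P) * (1 - eta) ^ number k)"
proof -
  have "no_click P eta $ i $ j = diag (\<lambda>k. (1 - P) * (1 - eta) ^ number k) $ i $ j" for i j
    by (cases i; cases j)
      (simp_all add: no_click_def number_proj_def density_def axis_def diag_nth, 
       simp_all add: scaleR_complex)
  then show ?thesis by (simp add: vec_eq_iff)
qed

text \<open>The eigenvalue of \<open>detector P eta j\<close> on the \<open>k\<close>-photon state:
  the probability of outcome \<open>j\<close> when \<open>k\<close> photons arrive.\<close>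

definition click_prob :: "real \<Rightarrow> real \<Rightarrow> nat \<Rightarrow> photons \<Rightarrow> real" where
  "click_prob P eta j k =
     (if j = 0 then (1 - P) * (1 - eta) ^ number k else 1 - (1 - P) * (1 - eta) ^ number k)"

lemma detector_eq_diag: "detector P eta j = diag (click_prob P eta j)"
  by (auto simp: detector_def click_prob_def no_click_eq_diag mat_1_eq_diag diag_diff fun_eq_iff
      intro!: arg_cong[where f = diag])

lemma click_prob_nonneg:
  assumes "0 \<le> P" "P \<le> 1" "0 \<le> eta" "eta \<le> 1"
  shows "0 \<le> click_prob P eta j k"
proof -
  have "(1 - P) * (1 - eta) ^ number k \<le> 1"
    using assms by (intro mult_le_one power_le_one) auto
  then show ?thesis
    using assms by (simp add: click_prob_def)
qed

lemma detect4_eq_diag: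
  "detect4 P eta j k l m = diag (\<lambda>((x1, x2), (x3, x4)).
     click_prob P eta j x1 * click_prob P eta k x2 *
     (click_prob P eta l x3 * click_prob P eta m x4))"
  by (auto simp: detect4_def detector_eq_diag tensor_diag intro!: arg_cong[where f = diag])

lemma matrix_mult_nth: "(A ** B) $ i $ j = (\<Sum>k\<in>UNIV. A $ i $ k * B $ k $ j)"
  by (simp add: matrix_matrix_mult_def)

section \<open>The beamsplitter on states with at most one photon per input mode\<close>

lemma creation_first:
  "((creation \<otimes>\<^sub>o mat 1) *v w) $ (p, q :: photons) =
     (case p of N0 \<Rightarrow> 0 | N1 \<Rightarrow> w $ (N0, q) | N2 \<Rightarrow> of_real (sqrt 2) * w $ (N1, q))"
  by (cases p; cases q) (simp_all add: matrix_vector_mult_def sum_UNIV_prod sum_photons tensor_def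
      creation_def mat_def)

lemma creation_second:
  "((mat 1 \<otimes>\<^sub>o creation) *v w) $ (p :: photons, q) =
     (case q of N0 \<Rightarrow> 0 | N1 \<Rightarrow> w $ (p, N0) | N2 \<Rightarrow> of_real (sqrt 2) * w $ (p, N1))"
  by (cases p; cases q) (simp_all add: matrix_vector_mult_def sum_UNIV_prod sum_photons tensor_def
      creation_def mat_def)

lemma scaleR_mult_vector_nth:
  "((r *\<^sub>R A) *v (w :: complex ^ 'n)) $ i = of_real r * (A *v w) $ i"
  by (simp add: matrix_vector_mult_def sum_distrib_left scaleR_complex mult.assoc)

lemmas beamsplitter_column_simps = beamsplitter_def beamsplitter_ket_def Let_def scaleR_mult_vector_nth
  matrix_vector_mult_add_rdistrib matrix_vector_mult_diff_rdistrib
  creation_first creation_second axis_def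

lemma beamsplitter_vacuum: "beamsplitter $ x $ (N0, N0) = (if x = (N0, N0) then 1 else 0)"
  by (simp add: beamsplitter_def beamsplitter_ket_def axis_def)

lemma beamsplitter_first:
  "beamsplitter $ (p, q) $ (N1, N0) =
     (if (p, q) = (N1, N0) \<or> (p, q) = (N0, N1) then of_real (1 / sqrt 2) else 0)"
  by (cases p; cases q) (simp_all add: beamsplitter_column_simps)

lemma beamsplitter_second:
  "beamsplitter $ (p, q) $ (N0, N1) =
     (if (p, q) = (N1, N0) then of_real (1 / sqrt 2) else
      if (p, q) = (N0, N1) then - of_real (1 / sqrt 2) else 0)"
  by (cases p; cases q) (simp_all add: beamsplitter_column_simps)

text \<open>Hong-Ou-Mandel bunching: in \<open>(b + c) (b - c) / 2\<close> the cross terms cancel,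
  and each squared creation operator yields \<open>sqrt 2\<close> times a two-photon state.\<close>

lemma beamsplitter_pair:
  "beamsplitter $ (p, q) $ (N1, N1) =
     (if (p, q) = (N2, N0) then of_real (1 / sqrt 2) else
      if (p, q) = (N0, N2) then - of_real (1 / sqrt 2) else 0)"
proof -
  have "sqrt 2 * sqrt 2 = (2::real)" by simp
  then show ?thesis
    by (cases p; cases q) (simp_all add: beamsplitter_column_simps field_simps flip: of_real_mult)
qed

section \<open>Operators on the two measured qubits and the partial trace\<close>

text \<open>Separates the outer indices \<open>a\<close>, \<open>d\<close> from the measured index
  \<open>x\<close>: for fixed \<open>a\<close>, \<open>d\<close> the range is one block, and
  \<open>on_bc X\<close> is block diagonal with a copy of \<open>X\<close> in each block.\<close>

definition place :: "modes2 \<Rightarrow> modes2 \<Rightarrow> modes4 \<Rightarrow> modes4 \<times> modes4" where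
  "place a d x = ((a, fst x), (snd x, d))"

lemma sum_place:
  assumes "\<And>b c a' d'. (a', d') \<noteq> (a, d) \<Longrightarrow> f ((a', b), (c, d')) = 0"
  shows "(\<Sum>z\<in>UNIV. f z) = (\<Sum>x\<in>UNIV. f (place a d x))"
proof -
  have "inj (place a d)"
    by (auto simp: inj_def place_def)
  then have "(\<Sum>x\<in>UNIV. f (place a d x)) = sum f (range (place a d))"
    by (simp add: sum.reindex)
  also have "\<dots> = sum f UNIV"
  proof (rule sum.mono_neutral_left)
    show "\<forall>z\<in>UNIV - range (place a d). f z = 0"
    proof
      fix z assume "z \<in> UNIV - range (place a d)"
      moreover obtain a' b c d' where z: "z = ((a', b), (c, d'))"
        by (metis surj_pair)
      moreover have "((a, b), (c, d)) \<in> range (place a d)"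
        by (rule range_eqI[of _ _ "(b, c)"]) (simp add: place_def)
      ultimately show "f z = 0"
        using assms[of a' d' b c] by auto
    qed
  qed simp_all
  finally show ?thesis ..
qed

lemma on_bc_place:
  "on_bc X $ place a d x $ place a' d' y = (if a = a' \<and> d = d' then X $ x $ y else 0)"
  by (simp add: on_bc_def place_def)

lemma on_bc_eq_0:
  assumes "(a', d') \<noteq> (a, d)"
  shows "on_bc X $ place a d x $ ((a', b), (c, d')) = 0"
    and "on_bc X $ ((a', b), (c, d')) $ place a d x = 0"
  using assms by (auto simp: on_bc_def place_def)

lemma on_bc_mult_place:
  "(on_bc X ** Y) $ place a d x $ z = (\<Sum>y\<in>UNIV. X $ x $ y * Y $ place a d y $ z)"
  unfolding matrix_mult_nth
  by (rule trans[OF sum_place[of a d]]) (simp_all only: on_bc_eq_0 on_bc_place mult_zero_left simp_thms if_True)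

lemma mult_on_bc_place:
  "(Y ** on_bc X) $ z $ place a d x = (\<Sum>y\<in>UNIV. Y $ z $ place a d y * X $ y $ x)"
  unfolding matrix_mult_nth
  by (rule trans[OF sum_place[of a d]]) (simp_all only: on_bc_eq_0 on_bc_place mult_zero_right simp_thms if_True)

lemma tensor_place:
  "(\<sigma> \<otimes>\<^sub>o \<tau>) $ place a d u $ place a' d' v =
     \<sigma> $ (a, fst u) $ (a', fst v) * \<tau> $ (snd u, d) $ (snd v, d')"
  by (simp add: tensor_def place_def)

lemma place_cases: obtains a d x where "z = place a d x"
  by (cases z) (auto simp: place_def intro: that)

lemma on_bc_mult: "on_bc X ** on_bc Y = on_bc (X ** Y)"
proof -
  have "(on_bc X ** on_bc Y) $ z $ z' = on_bc (X ** Y) $ z $ z'" for z z'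
  proof -
    obtain a d x where z: "z = place a d x" by (rule place_cases)
    obtain a' d' x' where z': "z' = place a' d' x'" by (rule place_cases)
    show ?thesis
      by (cases "a = a' \<and> d = d'")
        (auto simp: z z' on_bc_mult_place on_bc_place matrix_mult_nth[of X Y])
  qed
  then show ?thesis by (simp add: vec_eq_iff)
qed

lemma dagger_on_bc: "dagger (on_bc X) = on_bc (dagger X)"
  by (auto simp: vec_eq_iff dagger_def on_bc_def)

lemma trace_bc_nth:
  "trace_bc X $ (a, d) $ (a', d') = (\<Sum>x\<in>UNIV. X $ place a d x $ place a' d' x)"
  by (simp add: trace_bc_def place_def sum_UNIV_prod[where 'a = modes2 and 'b = modes2])

lemma trace_trace_bc: "trace (trace_bc X) = trace X"
proof -
  have swap: "(\<Sum>d\<in>UNIV. \<Sum>b\<in>UNIV. \<Sum>c\<in>UNIV. f b c d) = (\<Sum>b\<in>UNIV. \<Sum>c\<in>UNIV. \<Sum>d\<in>UNIV. f b c d)"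
    for f :: "modes2 \<Rightarrow> modes2 \<Rightarrow> modes2 \<Rightarrow> complex"
  proof -
    have "(\<Sum>d\<in>UNIV. \<Sum>b\<in>UNIV. \<Sum>c\<in>UNIV. f b c d) = (\<Sum>b\<in>UNIV. \<Sum>d\<in>UNIV. \<Sum>c\<in>UNIV. f b c d)"
      by (rule sum.swap)
    also have "\<dots> = (\<Sum>b\<in>UNIV. \<Sum>c\<in>UNIV. \<Sum>d\<in>UNIV. f b c d)"
      by (rule sum.cong[OF refl sum.swap])
    finally show ?thesis .
  qed
  have "trace (trace_bc X) = (\<Sum>a\<in>UNIV. \<Sum>d\<in>UNIV. \<Sum>b\<in>UNIV. \<Sum>c\<in>UNIV.
      X $ ((a, b), (c, d)) $ ((a, b), (c, d)))"
    by (simp add: trace_def trace_bc_def sum_UNIV_prod[where 'a = modes2 and 'b = modes2])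
  also have "\<dots> = (\<Sum>a\<in>UNIV. \<Sum>b\<in>UNIV. \<Sum>c\<in>UNIV. \<Sum>d\<in>UNIV.
      X $ ((a, b), (c, d)) $ ((a, b), (c, d)))"
    by (rule sum.cong[OF refl swap])
  also have "\<dots> = trace X"
    by (simp add: trace_def sum_UNIV_prod[where 'a = modes2 and 'b = modes2]
        sum_UNIV_prod[where 'a = modes4 and 'b = modes4])
  finally show ?thesis .
qed

text \<open>
  Cyclicity of the partial trace moves \<open>U\<close> and \<open>\<surd>E\<close> onto one side, so a swap depends only on
  \<open>G = U\<^sup>\<dagger> E U\<close>.  In particular only \<open>(\<surd>E)\<^sup>2 = E\<close> matters, not the choice of the root.
\<close>

definition swap_kernel :: "modes4 operator \<Rightarrow> state2 \<Rightarrow> state2 \<Rightarrow> state2" where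
  "swap_kernel G \<sigma> \<tau> = (\<chi> x y. \<Sum>u\<in>UNIV. \<Sum>v\<in>UNIV.
     G $ v $ u * \<sigma> $ (fst x, fst u) $ (fst y, fst v) * \<tau> $ (snd u, snd x) $ (snd v, snd y))"

text \<open>\<open>A\<close> and \<open>B\<close> act only on the systems traced out, so the trace
  may be cycled within those systems.\<close>

lemma trace_bc_sandwich:
  "trace_bc (on_bc A ** (\<sigma> \<otimes>\<^sub>o \<tau>) ** on_bc B) = swap_kernel (B ** A) \<sigma> \<tau>"
proof -
  have "trace_bc (on_bc A ** (\<sigma> \<otimes>\<^sub>o \<tau>) ** on_bc B) $ (a, d) $ (a', d')
      = swap_kernel (B ** A) \<sigma> \<tau> $ (a, d) $ (a', d')" for a d a' d'
  proof -
    let ?T = "\<lambda>u v. \<sigma> $ (a, fst u) $ (a', fst v) * \<tau> $ (snd u, d) $ (snd v, d')"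
    have "trace_bc (on_bc A ** (\<sigma> \<otimes>\<^sub>o \<tau>) ** on_bc B) $ (a, d) $ (a', d') =
        (\<Sum>x\<in>UNIV. \<Sum>v\<in>UNIV. \<Sum>u\<in>UNIV. B $ v $ x * A $ x $ u * ?T u v)"
      by (simp add: trace_bc_nth mult_on_bc_place on_bc_mult_place sum_distrib_left sum_distrib_right
          tensor_place ac_simps)
    \<comment> \<open>The interchanges bring \<open>x\<close> innermost, where it sums to an entry
      of \<open>B ** A\<close>.\<close>
    also have "\<dots> = (\<Sum>v\<in>UNIV. \<Sum>x\<in>UNIV. \<Sum>u\<in>UNIV. B $ v $ x * A $ x $ u * ?T u v)"
      by (rule sum.swap)
    also have "\<dots> = (\<Sum>v\<in>UNIV. \<Sum>u\<in>UNIV. \<Sum>x\<in>UNIV. B $ v $ x * A $ x $ u * ?T u v)"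
      by (rule sum.cong[OF refl sum.swap])
    also have "\<dots> = (\<Sum>u\<in>UNIV. \<Sum>v\<in>UNIV. \<Sum>x\<in>UNIV. B $ v $ x * A $ x $ u * ?T u v)"
      by (rule sum.swap)
    finally show ?thesis
      by (simp add: swap_kernel_def matrix_mult_nth sum_distrib_right mult.assoc)
  qed
  then show ?thesis by (auto simp: vec_eq_iff)
qed

text \<open>The POVM element pulled back through the beamsplitters to the incoming modes (Heisenberg
  picture).\<close>

abbreviation response :: "modes4 operator \<Rightarrow> modes4 operator" where
  "response E \<equiv> dagger beamsplitters ** E ** beamsplitters"

lemma bsm_prob_eq:
  "bsm_prob P eta \<sigma> \<tau> S = Re (trace (swap_kernel (response (bsm_povm P eta S)) \<sigma> \<tau>))"
proof -
  have "on_bc (bsm_povm P eta S) ** bsm_input \<sigma> \<tau> =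
      on_bc (bsm_povm P eta S ** beamsplitters) ** (\<sigma> \<otimes>\<^sub>o \<tau>) ** on_bc (dagger beamsplitters)"
    by (simp add: bsm_input_def matrix_mul_assoc on_bc_mult dagger_on_bc)
  then show ?thesis
    unfolding bsm_prob_def
    by (simp add: trace_bc_sandwich matrix_mul_assoc flip: trace_trace_bc)
qed

lemma bsm_state_eq:
  assumes "op_sqrt (bsm_povm P eta S) ** op_sqrt (bsm_povm P eta S) = bsm_povm P eta S"
  shows "bsm_state P eta \<sigma> \<tau> S =
     (1 / bsm_prob P eta \<sigma> \<tau> S) *\<^sub>R swap_kernel (response (bsm_povm P eta S)) \<sigma> \<tau>"
proof -
  let ?R = "op_sqrt (bsm_povm P eta S)"
  have "on_bc ?R ** bsm_input \<sigma> \<tau> ** on_bc ?R =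
      on_bc (?R ** beamsplitters) ** (\<sigma> \<otimes>\<^sub>o \<tau>) ** on_bc (dagger beamsplitters ** ?R)"
    by (simp add: bsm_input_def matrix_mul_assoc on_bc_mult dagger_on_bc flip: on_bc_mult)
  moreover have "dagger beamsplitters ** ?R ** (?R ** beamsplitters) = response (bsm_povm P eta S)"
    by (metis assms matrix_mul_assoc)
  ultimately show ?thesis
    by (simp add: bsm_state_def trace_bc_sandwich)
qed

section \<open>Detector response behind the beamsplitters\<close>

text \<open>Matrix entries of the pulled-back effect for a single beamsplitter whose outputs meet
  detectors with effects \<open>diag f\<close> and \<open>diag h\<close>.\<close>

definition pair_response ::
  "(photons \<Rightarrow> real) \<Rightarrow> (photons \<Rightarrow> real) \<Rightarrow> modes2 \<Rightarrow> modes2 \<Rightarrow> complex" where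
  "pair_response f h y x = (\<Sum>p\<in>UNIV. \<Sum>q\<in>UNIV.
     cnj (beamsplitter $ (p, q) $ y) * of_real (f p * h q) * beamsplitter $ (p, q) $ x)"

text \<open>One beamsplitter feeds detectors 1 and 3, the other feeds 2 and 4, so a product effect
  factorises over the two beamsplitters.\<close>

lemma response_diag:
  "response (diag (\<lambda>((x1, x2), (x3, x4)). f1 x1 * f2 x2 * (f3 x3 * f4 x4)))
     $ ((b1, b2), (c1, c2)) $ ((b1', b2'), (c1', c2')) =
   pair_response f1 f3 (b1, c1) (b1', c1') * pair_response f2 f4 (b2, c2) (b2', c2')"
  by (simp add: matrix_mult_nth[of "_ ** _"] mult_diag_nth pair_response_def sum_UNIV_prod
      sum_product dagger_def beamsplitters_def algebra_simps)

lemmas beamsplitter_qubits =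
  beamsplitter_vacuum beamsplitter_first beamsplitter_second beamsplitter_pair

lemma sqrt_2_mult_sqrt_2: "complex_of_real (sqrt 2) * complex_of_real (sqrt 2) = 2"
  by (simp flip: of_real_mult)

text \<open>Photon-number conservation kills the entries between different totals. A single photon
  leaves by either port, with a relative sign between the two inputs; two photons bunch, hence the
  terms with \<open>N2\<close>.\<close>

lemma pair_response_simps:
  "pair_response f h (N0, N0) (N0, N0) = of_real (f N0 * h N0)"
  "pair_response f h (N1, N0) (N1, N0) = of_real ((f N1 * h N0 + f N0 * h N1) / 2)"
  "pair_response f h (N0, N1) (N0, N1) = of_real ((f N1 * h N0 + f N0 * h N1) / 2)"
  "pair_response f h (N1, N0) (N0, N1) = of_real ((f N1 * h N0 - f N0 * h N1) / 2)"
  "pair_response f h (N0, N1) (N1, N0) = of_real ((f N1 * h N0 - f N0 * h N1) / 2)"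
  "pair_response f h (N1, N1) (N1, N1) = of_real ((f N2 * h N0 + f N0 * h N2) / 2)"
  "pair_response f h (N0, N0) (N1, N0) = 0"
  "pair_response f h (N0, N0) (N0, N1) = 0"
  "pair_response f h (N0, N0) (N1, N1) = 0"
  "pair_response f h (N1, N0) (N0, N0) = 0"
  "pair_response f h (N0, N1) (N0, N0) = 0"
  "pair_response f h (N1, N1) (N0, N0) = 0"
  "pair_response f h (N1, N1) (N1, N0) = 0"
  "pair_response f h (N1, N1) (N0, N1) = 0"
  "pair_response f h (N1, N0) (N1, N1) = 0"
  "pair_response f h (N0, N1) (N1, N1) = 0"
  using sqrt_2_mult_sqrt_2
  by (simp_all add: pair_response_def sum_photons beamsplitter_qubits field_simps)

section \<open>A family of two-qubit states closed under swapping\<close>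

abbreviation ket_H :: modes2 where "ket_H \<equiv> (N1, N0)"
abbreviation ket_V :: modes2 where "ket_V \<equiv> (N0, N1)"

definition qubit :: "modes2 set" where "qubit = {ket_H, ket_V}"

text \<open>
  This family contains \<open>|M\<^sup>\<plusminus>\<rangle>\<langle>M\<^sup>\<plusminus>|\<close> (\<open>p = 1/2\<close>, \<open>s = \<plusminus>1/2\<close>, \<open>g = 0\<close>) and is closed under swapping.
\<close>

definition bell_mix :: "real \<Rightarrow> real \<Rightarrow> real \<Rightarrow> state2" where
  "bell_mix p s g = (\<chi> x y.
     if fst x \<in> qubit \<and> snd x \<in> qubit then
       if x = y then (if fst x = snd x then of_real g else of_real p)
       else if fst x \<noteq> snd x \<and> y = (snd x, fst x) then of_real s else 0
     else 0)"

lemma bell_mix_eq_0: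
  assumes "x \<notin> qubit \<times> qubit \<or> y \<notin> qubit \<times> qubit"
  shows "bell_mix p s g $ x $ y = 0"
proof -
  have outside: "bell_mix p s g $ x $ y = 0" if "\<not> (fst x \<in> qubit \<and> snd x \<in> qubit)"
    unfolding bell_mix_def vec_lambda_beta if_not_P[OF that] ..
  have "bell_mix p s g $ x $ y = 0" if "fst x \<in> qubit" "snd x \<in> qubit" "y \<notin> qubit \<times> qubit"
  proof -
    have "x \<noteq> y"
      using that by (metis mem_Times_iff)
    moreover have "y \<noteq> (snd x, fst x)"
      using that by (metis mem_Times_iff fst_conv snd_conv)
    ultimately show ?thesis
      unfolding bell_mix_def vec_lambda_beta by (simp only: simp_thms if_False if_cancel)
  qed
  then show ?thesis
    using assms outside by (metis mem_Times_iff)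
qed

lemma bell_mix_nonzeroD:
  assumes "bell_mix p s g $ x $ y \<noteq> 0"
  shows "x \<in> qubit \<times> qubit \<and> y \<in> qubit \<times> qubit"
  using assms bell_mix_eq_0 by blast

lemma bell_mix_simps:
  "bell_mix p s g $ (ket_H, ket_H) $ (ket_H, ket_H) = of_real g"
  "bell_mix p s g $ (ket_H, ket_H) $ (ket_H, ket_V) = 0"
  "bell_mix p s g $ (ket_H, ket_H) $ (ket_V, ket_H) = 0"
  "bell_mix p s g $ (ket_H, ket_H) $ (ket_V, ket_V) = 0"
  "bell_mix p s g $ (ket_H, ket_V) $ (ket_H, ket_H) = 0"
  "bell_mix p s g $ (ket_H, ket_V) $ (ket_H, ket_V) = of_real p"
  "bell_mix p s g $ (ket_H, ket_V) $ (ket_V, ket_H) = of_real s"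
  "bell_mix p s g $ (ket_H, ket_V) $ (ket_V, ket_V) = 0"
  "bell_mix p s g $ (ket_V, ket_H) $ (ket_H, ket_H) = 0"
  "bell_mix p s g $ (ket_V, ket_H) $ (ket_H, ket_V) = of_real s"
  "bell_mix p s g $ (ket_V, ket_H) $ (ket_V, ket_H) = of_real p"
  "bell_mix p s g $ (ket_V, ket_H) $ (ket_V, ket_V) = 0"
  "bell_mix p s g $ (ket_V, ket_V) $ (ket_H, ket_H) = 0"
  "bell_mix p s g $ (ket_V, ket_V) $ (ket_H, ket_V) = 0"
  "bell_mix p s g $ (ket_V, ket_V) $ (ket_V, ket_H) = 0"
  "bell_mix p s g $ (ket_V, ket_V) $ (ket_V, ket_V) = of_real g"
  by (simp_all add: bell_mix_def qubit_def)

lemma density_M_plus: "density M_plus = bell_mix (1 / 2) (1 / 2) 0"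
proof -
  have half: "complex_of_real (1 / sqrt 2) * complex_of_real (1 / sqrt 2) =
      of_real (1 / 2)"
    by (simp flip: of_real_mult)
  have M: "M_plus $ x =
      (if x = (ket_H, ket_V) \<or> x = (ket_V, ket_H) then of_real (1 / sqrt 2) else 0)" for x
    by (simp add: M_plus_def axis_def scaleR_complex)
  have "density M_plus $ x $ y = bell_mix (1 / 2) (1 / 2) 0 $ x $ y" for x y
  proof (cases "x \<in> qubit \<times> qubit \<and> y \<in> qubit \<times> qubit")
    case True
    have "density M_plus $ x $ y = M_plus $ x * cnj (M_plus $ y)"
      by (simp only: density_def vec_lambda_beta)
    with True show ?thesis
      unfolding qubit_def
      by (elim conjE SigmaE insertE emptyE) (use half in \<open>simp_all add: M bell_mix_simps\<close>)
  next
    case False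
    have "(ket_H, ket_V) \<in> qubit \<times> qubit" "(ket_V, ket_H) \<in> qubit \<times> qubit"
      by (simp_all add: qubit_def)
    with False have "M_plus $ x = 0 \<or> M_plus $ y = 0"
      unfolding M by metis
    with False show ?thesis
      by (simp only: density_def vec_lambda_beta) (metis bell_mix_eq_0 mult_eq_0_iff complex_cnj_zero)
  qed
  then show ?thesis by (simp add: vec_eq_iff)
qed

lemma eq_on_qubits:
  fixes A :: state2
  assumes "\<And>x y. x \<notin> qubit \<times> qubit \<or> y \<notin> qubit \<times> qubit \<Longrightarrow> A $ x $ y = B $ x $ y"
    and "\<And>a b c d. a \<in> qubit \<Longrightarrow> b \<in> qubit \<Longrightarrow> c \<in> qubit \<Longrightarrow> d \<in> qubit \<Longrightarrow>
      A $ (a, b) $ (c, d) = B $ (a, b) $ (c, d)"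
  shows "A = B"
  unfolding vec_eq_iff using assms by (metis mem_Sigma_iff surj_pair)

lemma bell_mix_scaleR: "r *\<^sub>R bell_mix p s g = bell_mix (r * p) (r * s) (r * g)"
proof (rule eq_on_qubits)
  fix a b c d assume "a \<in> qubit" "b \<in> qubit" "c \<in> qubit" "d \<in> qubit"
  then show "(r *\<^sub>R bell_mix p s g) $ (a, b) $ (c, d) =
      bell_mix (r * p) (r * s) (r * g) $ (a, b) $ (c, d)"
    unfolding qubit_def by (elim insertE emptyE) (simp_all add: bell_mix_simps scaleR_complex)
qed (simp add: bell_mix_eq_0)

lemma sum_qubit: "(\<Sum>x\<in>qubit \<times> qubit. f x) =
   f (ket_H, ket_H) + f (ket_H, ket_V) + f (ket_V, ket_H) + f (ket_V, ket_V)"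
proof -
  have "qubit \<times> qubit = {(ket_H, ket_H), (ket_H, ket_V), (ket_V, ket_H), (ket_V, ket_V)}"
    by (auto simp: qubit_def)
  then show ?thesis by (simp add: add.assoc)
qed

text \<open>The coherence \<open>s\<close> lies off the diagonal, so it drops out.\<close>

lemma trace_bell_mix_diag:
  "Re (trace (bell_mix p s g ** diag f)) =
     p * (f (ket_H, ket_V) + f (ket_V, ket_H)) + g * (f (ket_H, ket_H) + f (ket_V, ket_V))"
proof -
  have "trace (bell_mix p s g ** diag f) =
      (\<Sum>x\<in>qubit \<times> qubit. bell_mix p s g $ x $ x * of_real (f x))"
    unfolding trace_def mult_diag_nth
    by (rule sum.mono_neutral_right) (simp_all add: bell_mix_eq_0 del: split_paired_All)
  also have "\<dots> = of_real (p * (f (ket_H, ket_V) + f (ket_V, ket_H)) +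
      g * (f (ket_H, ket_H) + f (ket_V, ket_V)))"
    unfolding sum_qubit by (simp add: bell_mix_simps algebra_simps)
  finally show ?thesis by simp
qed

lemma trace_bell_mix: "Re (trace (bell_mix p s g)) = 2 * (p + g)"
  using trace_bell_mix_diag[of p s g "\<lambda>_. 1"] by (simp flip: mat_1_eq_diag)

text \<open>For opposite outer qubits, two anticorrelated or two correlated inputs make the middle
  qubits opposite (weight \<open>u\<close>), and one of each makes them equal (weight
  \<open>k\<close>); equal outer qubits exchange these roles. A coherence survives only if both
  inputs contribute theirs, hence \<open>v * s\<^sup>2\<close>.\<close>

lemma swap_kernel_bell_mix:
  assumes "\<And>x y. x \<in> qubit \<times> qubit \<Longrightarrow> y \<in> qubit \<times> qubit \<Longrightarrow> G $ x $ y = bell_mix u v k $ x $ y"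
  shows "swap_kernel G (bell_mix p s g) (bell_mix p s g) =
    bell_mix (u * (p\<^sup>2 + g\<^sup>2) + 2 * k * p * g) (v * s\<^sup>2) (k * (p\<^sup>2 + g\<^sup>2) + 2 * u * p * g)"
proof -
  let ?B = "bell_mix p s g"
  let ?R = "bell_mix (u * (p\<^sup>2 + g\<^sup>2) + 2 * k * p * g) (v * s\<^sup>2) (k * (p\<^sup>2 + g\<^sup>2) + 2 * u * p * g)"
  have outer: "swap_kernel G ?B ?B $ x $ y = 0" if "x \<notin> qubit \<times> qubit \<or> y \<notin> qubit \<times> qubit" for x y
  proof -
    have zero: "?B $ (fst x, b) $ (fst y, b') * ?B $ (c, snd x) $ (c', snd y) = 0" for b b' c c'
      using that bell_mix_nonzeroD[of p s g "(fst x, b)" "(fst y, b')"]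
        bell_mix_nonzeroD[of p s g "(c, snd x)" "(c', snd y)"]
      by (auto simp: mem_Times_iff)
    show ?thesis
      by (simp only: swap_kernel_def vec_lambda_beta mult.assoc zero mult_zero_right sum.neutral_const)
  qed
  have inner: "swap_kernel G ?B ?B $ (a, d) $ (a', d') = ?R $ (a, d) $ (a', d')"
    if "a \<in> qubit" "d \<in> qubit" "a' \<in> qubit" "d' \<in> qubit" for a d a' d'
  proof -
    let ?F = "\<lambda>w z. G $ z $ w * ?B $ (a, fst w) $ (a', fst z) * ?B $ (snd w, d) $ (snd z, d')"
    have "swap_kernel G ?B ?B $ (a, d) $ (a', d') = (\<Sum>w\<in>UNIV. \<Sum>z\<in>UNIV. ?F w z)"
      by (simp add: swap_kernel_def)
    \<comment> \<open>Both inputs are supported on the qubit space, which is also where the entries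
      of \<open>G\<close> are known.\<close>
    also have "\<dots> = (\<Sum>w\<in>qubit \<times> qubit. \<Sum>z\<in>qubit \<times> qubit. ?F w z)"
    proof -
      have F: "?F w z = 0" if "w \<notin> qubit \<times> qubit \<or> z \<notin> qubit \<times> qubit" for w z
        using that bell_mix_nonzeroD[of p s g "(a, fst w)" "(a', fst z)"]
          bell_mix_nonzeroD[of p s g "(snd w, d)" "(snd z, d')"]
        by (auto simp: mem_Times_iff simp del: split_paired_All split_paired_Ex)
      have "(\<Sum>z\<in>UNIV. ?F w z) = (\<Sum>z\<in>qubit \<times> qubit. ?F w z)" for w
        by (rule sum.mono_neutral_right) (simp_all add: F del: split_paired_All mult_eq_0_iff)
      moreover have "(\<Sum>w\<in>UNIV. \<Sum>z\<in>qubit \<times> qubit. ?F w z) = (\<Sum>w\<in>qubit \<times> qubit. \<Sum>z\<in>qubit \<times> qubit. ?F w z)"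
        by (rule sum.mono_neutral_right) (simp_all add: F del: split_paired_All mult_eq_0_iff)
      ultimately show ?thesis by simp
    qed
    also have "\<dots> = (\<Sum>w\<in>qubit \<times> qubit. \<Sum>z\<in>qubit \<times> qubit. bell_mix u v k $ z $ w *
        ?B $ (a, fst w) $ (a', fst z) * ?B $ (snd w, d) $ (snd z, d'))"
      by (intro sum.cong refl) (simp add: assms)
    also have "\<dots> = ?R $ (a, d) $ (a', d')"
      using that unfolding sum_qubit unfolding qubit_def
      by (elim insertE emptyE) (simp_all add: bell_mix_simps power2_eq_square algebra_simps)
    finally show ?thesis .
  qed
  show ?thesis
    by (rule eq_on_qubits) (simp_all add: outer inner bell_mix_eq_0)
qed

lemma phase_flip_eq_diag: "phase_flip = diag (\<lambda>x. if x = ket_V then - 1 else 1)"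
  by (simp add: vec_eq_iff phase_flip_def diag_nth)

text \<open>The signs of row and column multiply to -1 only where the second qubit differs, that is,
  at the coherence.\<close>

lemma phase_flip_bell_mix:
  "(mat 1 \<otimes>\<^sub>o phase_flip) ** bell_mix p s g ** dagger (mat 1 \<otimes>\<^sub>o phase_flip) = bell_mix p (- s) g"
  unfolding phase_flip_eq_diag mat_1_eq_diag tensor_diag dagger_diag
proof (rule eq_on_qubits, goal_cases)
  case (1 x y)
  then show ?case by (simp add: mult_diag_nth diag_mult_nth bell_mix_eq_0)
next
  case (2 a b c d)
  then show ?case
    unfolding qubit_def
    by (elim insertE emptyE) (simp_all add: mult_diag_nth diag_mult_nth bell_mix_simps)
qed

section \<open>The four successful outcomes\<close>

text \<open>Two equal qubits send both photons into one beamsplitter and vacuum into the other; the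
  two equations for \<open>k\<close> are the two choices of that beamsplitter. Opposite qubits send
  one photon into each, giving \<open>u\<close> and \<open>v\<close>.\<close>

lemma response_bell_mix:
  assumes "(f1 N2 * f3 N0 + f1 N0 * f3 N2) / 2 * (f2 N0 * f4 N0) = k"
    and "f1 N0 * f3 N0 * ((f2 N2 * f4 N0 + f2 N0 * f4 N2) / 2) = k"
    and "(f1 N1 * f3 N0 + f1 N0 * f3 N1) / 2 * ((f2 N1 * f4 N0 + f2 N0 * f4 N1) / 2) = u"
    and "(f1 N1 * f3 N0 - f1 N0 * f3 N1) / 2 * ((f2 N1 * f4 N0 - f2 N0 * f4 N1) / 2) = v"
    and "x \<in> qubit \<times> qubit" "y \<in> qubit \<times> qubit"
  shows "response (diag (\<lambda>((x1, x2), (x3, x4)). f1 x1 * f2 x2 * (f3 x3 * f4 x4))) $ x $ y =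
    bell_mix u v k $ x $ y"
proof -
  let ?E = "diag (\<lambda>((x1, x2), (x3, x4)). f1 x1 * f2 x2 * (f3 x3 * f4 x4))"
  define G where "G = response ?E"
  have G: "G $ ((b1, b2), (c1, c2)) $ ((b1', b2'), (c1', c2')) =
      pair_response f1 f3 (b1, c1) (b1', c1') * pair_response f2 f4 (b2, c2) (b2', c2')"
    for b1 b2 c1 c2 b1' b2' c1' c2'
    unfolding G_def by (rule response_diag)
  \<comment> \<open>Only the outermost product is split under the cast to complex, so that the
    equations match products of entries from \<open>pair_response_simps\<close>.\<close>
  note eqs = assms(1-4)[THEN arg_cong[where f = complex_of_real], unfolded
      of_real_mult[of "_ / 2" "_ / 2"] of_real_mult[of "_ / 2" "_ * _"] of_real_mult[of "_ * _" "_ / 2"]]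
  have "G $ (a, b) $ (c, d) = bell_mix u v k $ (a, b) $ (c, d)"
    if "a \<in> qubit" "b \<in> qubit" "c \<in> qubit" "d \<in> qubit" for a b c d
    using that unfolding qubit_def
    by (elim insertE emptyE)
      (simp_all only: G pair_response_simps bell_mix_simps eqs mult_zero_left mult_zero_right)
  then have "G $ x $ y = bell_mix u v k $ x $ y"
    using assms(5,6) by (metis mem_Sigma_iff surj_pair)
  then show ?thesis
    by (simp only: G_def)
qed

text \<open>
  On the qubit space \<open>U\<^sup>\<dagger> E U\<close> has again the shape of \<open>bell_mix\<close>.  Its entries below are
  \<open>2 (a + b)\<close>, \<open>2 (a - b)\<close> and \<open>4 c\<close> in the notation of the theorem.
\<close>

definition opposite_response :: "real \<Rightarrow> real \<Rightarrow> real" where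
  "opposite_response P eta = (let A = eta + P * (1 - eta) in ((1 - P) * A + P * (1 - A))\<^sup>2 / 4)"

definition coherence_response :: "real \<Rightarrow> real \<Rightarrow> real" where
  "coherence_response P eta = (let A = eta + P * (1 - eta) in ((1 - P) * A - P * (1 - A))\<^sup>2 / 4)"

definition equal_response :: "real \<Rightarrow> real \<Rightarrow> real" where
  "equal_response P eta = (let B = 1 - (1 - P) * (1 - eta)\<^sup>2
     in P * (1 - P) * (P * (1 - B) + B * (1 - P)) / 2)"

text \<open>A success means one click behind each beamsplitter. Exchanging the clicking detector of
  one beamsplitter negates its half-difference, so the outcomes differ only in the sign of the
  coherence.\<close>

lemma response_bsm_povm:
  assumes "S \<in> bsm_success" "x \<in> qubit \<times> qubit" "y \<in> qubit \<times> qubit"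
  shows "response (bsm_povm P eta S) $ x $ y =
    bell_mix (opposite_response P eta)
      ((if S \<in> {{1, 4}, {2, 3}} then - 1 else 1) * coherence_response P eta)
      (equal_response P eta) $ x $ y"
proof -
  have neq: "{Suc 0, 2} \<noteq> {Suc 0, 4}" "{Suc 0, 2} \<noteq> {2, 3}"
    "({3, 4} :: nat set) \<noteq> {Suc 0, 4}" "({3, 4} :: nat set) \<noteq> {2, 3}"
    by (simp_all add: doubleton_eq_iff)
  \<comment> \<open>\<open>A\<close> and \<open>B\<close> are the click probabilities for one and
    for two arriving photons.\<close>
  define A where "A = eta + P * (1 - eta)"
  define B where "B = 1 - (1 - P) * (1 - eta)\<^sup>2"
  have clicks: "click_prob P eta 0 N0 = 1 - P" "click_prob P eta 0 N1 = 1 - A"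
    "click_prob P eta 0 N2 = 1 - B" "click_prob P eta (Suc 0) N0 = P"
    "click_prob P eta (Suc 0) N1 = A" "click_prob P eta (Suc 0) N2 = B"
    by (simp_all add: click_prob_def A_def B_def algebra_simps)
  have "S = {1, 2} \<or> S = {3, 4} \<or> S = {1, 4} \<or> S = {2, 3}"
    using assms(1) by (auto simp: bsm_success_def)
  then show ?thesis
    unfolding bsm_povm_def detect4_eq_diag
    apply (elim disjE)
       apply (rule response_bell_mix[OF _ _ _ _ assms(2,3)];
        simp add: neq clicks opposite_response_def coherence_response_def equal_response_def
          flip: A_def B_def;
        simp add: power2_eq_square algebra_simps)+
    done
qed

text \<open>The correcting phase flip undoes the sign of the coherence, so the right-hand side is
  free of \<open>S\<close>; this is what makes the \<open>THE\<close> in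
  \<open>swapped_state\<close> well defined.\<close>

lemma heralded_bell_mix:
  assumes "0 \<le> P" "P \<le> 1" "0 \<le> eta" "eta \<le> 1" "S \<in> bsm_success"
  shows "heralded_state P eta (bell_mix p s g) (bell_mix p s g) S =
    (let u = opposite_response P eta; k = equal_response P eta; p' = u * (p\<^sup>2 + g\<^sup>2) + 2 * k * p * g;
         g' = k * (p\<^sup>2 + g\<^sup>2) + 2 * u * p * g
     in (1 / (2 * (p' + g'))) *\<^sub>R bell_mix p' (coherence_response P eta * s\<^sup>2) g')"
proof -
  have sqrt: "op_sqrt (bsm_povm P eta S) ** op_sqrt (bsm_povm P eta S) = bsm_povm P eta S"
    unfolding bsm_povm_def detect4_eq_diag
    by (rule op_sqrt_diag) (use assms in \<open>auto simp: click_prob_nonneg\<close>)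
  have kernel: "swap_kernel (response (bsm_povm P eta S)) (bell_mix p s g) (bell_mix p s g) =
      bell_mix (opposite_response P eta * (p\<^sup>2 + g\<^sup>2) + 2 * equal_response P eta * p * g)
        ((if S \<in> {{1, 4}, {2, 3}} then - 1 else 1) * coherence_response P eta * s\<^sup>2)
        (equal_response P eta * (p\<^sup>2 + g\<^sup>2) + 2 * opposite_response P eta * p * g)"
    by (rule swap_kernel_bell_mix) (rule response_bsm_povm[OF assms(5)])
  show ?thesis
    unfolding heralded_state_def bsm_state_eq[OF sqrt] bsm_prob_eq kernel trace_bell_mix Let_def
    by (cases "S \<in> {{1, 4}, {2, 3}}")
      (simp_all only: if_True if_False simp_thms bell_mix_scaleR phase_flip_bell_mix mult_minus_left
        mult_minus_right minus_minus mult_1)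
qed

section \<open>Swapping, error rate and the chain\<close>

lemma single_click_pos:
  fixes P eta :: real
  assumes "0 \<le> P" "P \<le> 1" "0 < eta" "eta \<le> 1"
  shows "0 < eta + P * (1 - eta)" "eta + P * (1 - eta) \<le> 1"
proof -
  show "0 < eta + P * (1 - eta)"
    using assms by (simp add: add_pos_nonneg)
  have "0 \<le> (1 - P) * (1 - eta)"
    using assms by simp
  then show "eta + P * (1 - eta) \<le> 1"
    by (simp add: algebra_simps)
qed

text \<open>The unnormalised trace is \<open>2 * (u + k) * (p + g)\<^sup>2 = (u + k) / 2\<close>,
  positive because \<open>u > 0\<close> and \<open>k \<ge> 0\<close>. The coherence
  \<open>s'\<close> is left unspecified, since the error rate does not see it.\<close>

lemma swapped_bell_mix:
  assumes "0 \<le> P" "P < 1" "0 < eta" "eta \<le> 1" "p + g = 1 / 2"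
  defines "u \<equiv> opposite_response P eta" and "k \<equiv> equal_response P eta"
  obtains p' s' g' where
    "swapped_state P eta (bell_mix p s g) (bell_mix p s g) = bell_mix p' s' g'"
    "p' + g' = 1 / 2" "(p' - g') * (u + k) = 2 * (u - k) * (p - g)\<^sup>2"
    "u > 0" "u + k > 0"
proof -
  have "u > 0"
  proof -
    let ?A = "eta + P * (1 - eta)"
    have "0 < (1 - P) * ?A + P * (1 - ?A)"
      using single_click_pos[of P eta] assms(1-4)
      by (intro add_pos_nonneg mult_pos_pos mult_nonneg_nonneg) simp_all
    then show ?thesis
      by (simp only: u_def opposite_response_def Let_def zero_less_power zero_less_divide_iff simp_thms
          zero_less_numeral)
  qed
  have "0 \<le> k"
  proof -
    have "(1 - P) * (1 - eta)\<^sup>2 \<le> 1"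
      using assms(1-4) by (intro mult_le_one power_le_one) auto
    then show ?thesis
      using assms(1-4) unfolding k_def equal_response_def Let_def
      by (intro divide_nonneg_pos mult_nonneg_nonneg add_nonneg_nonneg) auto
  qed
  define p' g'
    where "p' = u * (p\<^sup>2 + g\<^sup>2) + 2 * k * p * g"
      and "g' = k * (p\<^sup>2 + g\<^sup>2) + 2 * u * p * g"
  let ?c = "1 / (2 * (p' + g'))"
  let ?R = "?c *\<^sub>R bell_mix p' (coherence_response P eta * s\<^sup>2) g'"
  have herald: "heralded_state P eta (bell_mix p s g) (bell_mix p s g) S = ?R"
    if "S \<in> bsm_success" for S
    using heralded_bell_mix[of P eta S p s g] that assms(1-4)
    by (simp add: Let_def p'_def g'_def u_def k_def)
  have "swapped_state P eta (bell_mix p s g) (bell_mix p s g) = ?R"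
    unfolding swapped_state_def
  \<comment> \<open>Uniqueness only takes one successful outcome, here
    \<open>{1, 2}\<close>.\<close>
  proof (rule the_equality)
    fix \<rho> assume "\<forall>S\<in>bsm_success. heralded_state P eta (bell_mix p s g) (bell_mix p s g) S = \<rho>"
    moreover have "{1, 2} \<in> bsm_success" by (simp add: bsm_success_def)
    ultimately show "\<rho> = ?R" using herald by metis
  qed (use herald in blast)
  then have swapped: "swapped_state P eta (bell_mix p s g) (bell_mix p s g) =
      bell_mix (?c * p') (?c * (coherence_response P eta * s\<^sup>2)) (?c * g')"
    by (simp only: bell_mix_scaleR)
  have sum: "p' + g' = (u + k) / 4"
  proof -
    have "p' + g' = (u + k) * (p + g)\<^sup>2"
      by (simp add: p'_def g'_def power2_eq_square algebra_simps)
    then show ?thesis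
      by (simp add: assms(5) power2_eq_square)
  qed
  have trace: "?c * p' + ?c * g' = 1 / 2"
  proof -
    have "?c * p' + ?c * g' = ?c * (p' + g')"
      by (rule distrib_left[symmetric])
    then show ?thesis
      using \<open>u > 0\<close> \<open>0 \<le> k\<close> by (simp add: sum)
  qed
  have contrast: "(?c * p' - ?c * g') * (u + k) = 2 * (u - k) * (p - g)\<^sup>2"
  proof -
    have "p' - g' = (u - k) * (p - g)\<^sup>2"
      by (simp add: p'_def g'_def power2_eq_square algebra_simps)
    moreover have "?c = 2 / (u + k)"
      unfolding sum using \<open>u > 0\<close> \<open>0 \<le> k\<close> by (simp add: field_simps)
    moreover have "?c * p' - ?c * g' = ?c * (p' - g')"
      by (rule right_diff_distrib[symmetric])
    ultimately show ?thesis
      using \<open>u > 0\<close> \<open>0 \<le> k\<close> by simp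
  qed
  show ?thesis
    by (rule that[OF swapped trace contrast]) (use \<open>u > 0\<close> \<open>0 \<le> k\<close> in simp_all)
qed

text \<open>Sifting asks for a click on each side, which has probability \<open>?D\<close> per side
  whatever the qubit. Double clicks count as half an error and so cancel in
  \<open>1 - 2 * qber\<close>; each side contributes the difference between the right and the wrong
  single click, divided by \<open>?D\<close>.\<close>

lemma qber_bell_mix:
  assumes "0 \<le> P" "P < 1" "0 < eta" "eta \<le> 1" "p + g = 1 / 2"
  defines "A \<equiv> eta + (1 - eta) * P"
  shows "1 - 2 * qber P eta (bell_mix p s g) =
    (((1 - P) * A - (1 - A) * P) / ((1 - P) * A + (1 - A) * P + P * A))\<^sup>2 * (2 * (p - g))"
proof -
  let ?f = "click_prob P eta"
  have A1: "?f 0 N1 = 1 - A" "?f (Suc 0) N1 = A" "?f 0 N0 = 1 - P" "?f (Suc 0) N0 = P"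
    by (simp_all add: click_prob_def A_def algebra_simps)
  let ?D = "(1 - P) * A + (1 - A) * P + P * A"
  have "0 < A" "A \<le> 1"
    using single_click_pos[of P eta] assms(1-4) by (simp_all add: A_def mult.commute)
  then have D: "?D > 0"
    using assms(1-4) by (simp add: add_pos_nonneg)
  have sift: "sift_prob P eta (bell_mix p s g) = ?D\<^sup>2"
  proof -
    have "sift_prob P eta (bell_mix p s g) = 2 * (p + g) * ?D\<^sup>2"
      unfolding sift_prob_def Let_def detect4_eq_diag diag_add trace_bell_mix_diag
      by (simp add: A1) (simp add: algebra_simps power2_eq_square)
    then show ?thesis using assms by simp
  qed
  have "qber P eta (bell_mix p s g) =
      1 / ?D\<^sup>2 * ((p + g) * ?D\<^sup>2 - (p - g) * ((1 - P) * A - (1 - A) * P)\<^sup>2)"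
    unfolding qber_def Let_def detect4_eq_diag diag_add diag_scaleR trace_bell_mix_diag sift
    by (simp add: A1) (simp add: algebra_simps power2_eq_square)
  \<comment> \<open>Stated for variables \<open>d\<close>, \<open>m\<close>, so that clearing
    denominators does not expand the click polynomials.\<close>
  moreover have "1 - 2 * (1 / d\<^sup>2 * ((p + g) * d\<^sup>2 - (p - g) * m\<^sup>2)) = (m / d)\<^sup>2 * (2 * (p - g))"
    if "d > 0" for d m :: real
  proof -
    have p: "p = 1 / 2 - g"
      using assms(5) by simp
    show ?thesis
      unfolding p using that by (simp add: power_divide field_simps)
  qed
  ultimately show ?thesis
    using D by (simp only:)
qed

text \<open>The invariant \<open>p + g = 1 / 2\<close> is unit trace, restored by the normalisation
  in every swap.\<close>

lemma chain_bell_mix: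
  assumes "0 \<le> P_e" "P_e < 1" "0 < eta1" "eta1 \<le> 1" "0 \<le> P_r" "P_r < 1" "0 < eta2" "eta2 \<le> 1"
  shows "\<exists>p s g. chain P_e eta1 P_r eta2 i = bell_mix p s g \<and> p + g = 1 / 2"
  using assms
proof (induction P_e eta1 P_r eta2 i rule: chain.induct)
  case (1 P_e eta1 P_r eta2)
  have "density M_plus = bell_mix (1 / 2) (1 / 2) 0" "1 / 2 + 0 = (1 / 2 :: real)"
    by (simp_all add: density_M_plus)
  then show ?case by (metis chain.simps(1))
next
  case (2 P_e eta1 P_r eta2)
  then show ?case
    by (metis chain.simps(2) density_M_plus swapped_bell_mix add.right_neutral)
next
  case (3 P_e eta1 P_r eta2 i)
  then show ?case
    by (metis chain.simps(3) swapped_bell_mix)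
qed

theorem corollary15:
  fixes n :: nat
    and eta_e eta_r eta_d lam lam_m P_e P_r P_d :: real
    and A_r B_r a b c w_r t_r A_d q1 q2 q3 t_d :: real
    and Q :: "nat \<Rightarrow> real"
  assumes "n \<ge> 1"
    and "eta_e \<in> {0<..1}" and "eta_r \<in> {0<..1}" and "eta_d \<in> {0<..1}"
    and "lam \<in> {0<..1}" and "lam_m \<in> {0<..1}"
    and "P_e \<in> {0..<1}" and "P_r \<in> {0..<1}" and "P_d \<in> {0..<1}"
    and "\<And>i. 1 \<le> i \<Longrightarrow> i \<le> n + 1 \<Longrightarrow>
           Q i = qber P_d eta_d (chain P_e (eta_e * lam) P_r (eta_r * lam_m) i)"
    and "A_r = eta_r * lam_m + P_r * (1 - eta_r * lam_m)"
    and "B_r = 1 - (1 - P_r) * (1 - eta_r * lam_m)\<^sup>2"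
    and "a = 1 / 8 * (P_r\<^sup>2 * (1 - A_r)\<^sup>2 + A_r\<^sup>2 * (1 - P_r)\<^sup>2)"
    and "b = 1 / 8 * (2 * A_r * P_r * (1 - A_r) * (1 - P_r))"
    and "c = 1 / 8 * P_r * (1 - P_r) * (P_r * (1 - B_r) + B_r * (1 - P_r))"
    and "w_r = c / (a + b)"
    and "t_r = (1 - 2 * w_r) / (1 + 2 * w_r)"
    and "A_d = eta_d + (1 - eta_d) * P_d"
    and "q1 = (1 - P_d) * A_d"
    and "q2 = (1 - A_d) * P_d"
    and "q3 = P_d * A_d"
    and "t_d = ((q1 - q2) / (q1 + q2 + q3))\<^sup>2"
  shows "\<forall>i\<in>{1..n}. 1 - 2 * Q (i + 1) = t_r / t_d * (1 - 2 * Q i)\<^sup>2"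
proof
  fix i assume i: "i \<in> {1..n}"
  define u where "u = opposite_response P_r (eta_r * lam_m)"
  define k where "k = equal_response P_r (eta_r * lam_m)"
  let ?\<rho> = "chain P_e (eta_e * lam) P_r (eta_r * lam_m)"
  have eta: "0 < eta_e * lam" "eta_e * lam \<le> 1" "0 < eta_r * lam_m" "eta_r * lam_m \<le> 1"
    using assms(2-6) by (auto intro: mult_le_one)
  have P: "0 \<le> P_e" "P_e < 1" "0 \<le> P_r" "P_r < 1" "0 \<le> P_d" "P_d < 1" "0 < eta_d" "eta_d \<le> 1"
    using assms(4,7-9) by auto
  obtain p s g where \<rho>: "?\<rho> i = bell_mix p s g" and pg: "p + g = 1 / 2"
    using chain_bell_mix[OF P(1,2) eta(1,2) P(3,4) eta(3,4)] by blast
  obtain p' s' g' where swap: "swapped_state P_r (eta_r * lam_m) (bell_mix p s g) (bell_mix p s g) =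
      bell_mix p' s' g'"
    and pg': "p' + g' = 1 / 2" and step: "(p' - g') * (u + k) = 2 * (u - k) * (p - g)\<^sup>2"
    and u: "u > 0" and uk: "u + k > 0"
    unfolding u_def k_def by (rule swapped_bell_mix[OF P(3,4) eta(3,4) pg])
  \<comment> \<open>As \<open>i \<ge> 1\<close>, the third equation of \<open>chain\<close> applies,
    the one with the repeater parameters.\<close>
  have "?\<rho> (i + 1) = bell_mix p' s' g'"
    using i \<rho> swap by (cases i) simp_all
  then have Q': "1 - 2 * Q (i + 1) = t_d * (2 * (p' - g'))"
    using i assms(10)[of "i + 1"] qber_bell_mix[OF P(5-8) pg', of s'] assms(18-22) by simp
  have Q: "1 - 2 * Q i = t_d * (2 * (p - g))"
    using i \<rho> assms(10)[of i] qber_bell_mix[OF P(5-8) pg, of s] assms(18-22) by simp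
  \<comment> \<open>With \<open>a + b = u / 2\<close> and \<open>c = k / 4\<close>,
    \<open>2 * w_r\<close> is \<open>k / u\<close>, and the denominator \<open>u\<close> cancels in
    \<open>t_r\<close>.\<close>
  have tr: "t_r = (u - k) / (u + k)"
  proof -
    have ab: "a + b = u / 2"
      unfolding assms(13,14) u_def opposite_response_def Let_def
      by (simp add: assms(11)[symmetric]) (simp add: power2_eq_square field_simps)
    have c: "c = k / 4"
      by (simp add: assms(15) k_def equal_response_def Let_def flip: assms(12))
    have w: "w_r = k / (2 * u)"
      unfolding assms(16) ab c by simp
    have "1 - 2 * w_r = (u - k) / u" "1 + 2 * w_r = (u + k) / u"
      using u by (simp_all add: w field_simps)
    then show ?thesis
      using u by (simp add: assms(17))
  qed
  have contrast: "p' - g' = 2 * (u - k) * (p - g)\<^sup>2 / (u + k)"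
    using step uk by (simp add: field_simps)
  have td: "t_d \<noteq> 0"
  proof -
    have A: "0 < A_d" "A_d \<le> 1"
      using single_click_pos[of P_d eta_d] P(5-8) by (simp_all add: assms(18) mult.commute)
    \<comment> \<open>The terms \<open>P_d * A_d\<close> cancel; what remains is positive because
      \<open>eta_d > 0\<close> and \<open>P_d < 1\<close>.\<close>
    have "q1 - q2 = eta_d * (1 - P_d)"
      by (simp add: assms(18-20) algebra_simps)
    moreover have "0 < q1 + q2 + q3"
      using A P by (simp add: assms(19-21) add_pos_nonneg)
    ultimately show ?thesis
      using P by (simp add: assms(22))
  qed
  \<comment> \<open>Here \<open>t\<close>, \<open>v\<close>, \<open>y\<close>, \<open>x\<close>
    stand for \<open>t_d\<close>, \<open>u - k\<close>, \<open>u + k\<close>, \<open>p - g\<close>.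
    The new contrast carries one factor \<open>t_d\<close>, the squared old one carries two; hence
    the division by \<open>t_d\<close>.\<close>
  have "t * (2 * (2 * v * x\<^sup>2 / y)) = v / y / t * (t * (2 * x))\<^sup>2" if "t \<noteq> 0" for t v x y :: real
    using that by (simp add: power2_eq_square)
  from this[OF td] show "1 - 2 * Q (i + 1) = t_r / t_d * (1 - 2 * Q i)\<^sup>2"
    unfolding Q Q' tr contrast .
qed

end
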